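(* $\mathfrak{x}_{<,\le}=\mathfrak{x}_{<,<}=\max\{\mathfrak{s},\mathfrak{b}\}$.
   Context: $\mathbb{N}^{\mathbb{N}}$ is the set of functions $\mathbb{N}\to\mathbb{N}$; $f\le^* g$ means $f(n)\le g(n)$ for all but finitely many $n$. $\mathfrak{b}$ is the minimal size of a subset of $\mathbb{N}^{\mathbb{N}}$ unbounded with respect to $\le^*$. $\mathfrak{s}$ is the minimal size of a family $\mathcal{F}$ of infinite subsets of $\mathbb{N}$ such that for every infinite $A\subseteq\mathbb{N}$ there is $S\in\mathcal{F}$ with $A\cap S$ and $A\setminus S$ both infinite. For $f,g\in\mathbb{N}^{\mathbb{N}}$ and a binary relation $R$ on $\mathbb{N}$, $[f R g]=\{n: f(n)Rg(n)\}$. For $R,S\in\{\le,<\}$, $X\subseteq\mathbb{N}^{\mathbb{N}}$ and $g\in\mathbb{N}^{\mathbb{N}}$, $g$ avoids middles in $X$ with respect to $\langle R,S\rangle$ if (1) for each $f\in X$ the set $[fRg]$ is infinite, and (2) for all $f,h\in X$ at least one of the sets $\{n: f(n)Rg(n)\text{ and }g(n)Sh(n)\}$ and $\{n: h(n)Rg(n)\text{ and }g(n)Sf(n)\}$ is finite. $X$ satisfies the excluded middle property with respect to $\langle R,S\rangle$ if some $g$ avoids middles in $X$ with respect to $\langle R,S\rangle$. $\mathfrak{x}_{R,S}$ is the minimal size of a subset of $\mathbb{N}^{\mathbb{N}}$ which does not satisfy the excluded middle property with respect to $\langle R,S\rangle$. *)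

theory Defs
  imports "HOL-Library.Infinite_Set"
begin

unbundle cardinal_syntax

text \<open>Cardinals are handled as in \<^theory>\<open>HOL.BNF_Cardinal_Order_Relation\<close>: a cardinal is represented
  by a cardinal order \<^term>\<open>|A|\<close>, and equality of cardinals is equinumerosity \<open>=o\<close>, which makes
  sense across types.\<close>

definition min_size :: "('a set \<Rightarrow> bool) \<Rightarrow> 'a rel" where
  "min_size P = (SOME \<kappa>. (\<exists>A. P A \<and> \<kappa> = |A| ) \<and> (\<forall>B. P B \<longrightarrow> \<kappa> \<le>o |B| ))"

text \<open>The \<open>SOME\<close> above is meaningful as soon as some set satisfies \<open>P\<close>.\<close>

lemma min_size:
  assumes "P A"
  shows "\<exists>A. P A \<and> min_size P = |A|" and "\<And>B. P B \<Longrightarrow> min_size P \<le>o |B|"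
proof -
  let ?R = "{|A| |A. P A}"
  have "?R \<noteq> {}" "\<forall>r\<in>?R. Card_order r"
    using assms card_of_Card_order by blast+
  from exists_minim_Card_order[OF this]
  obtain \<kappa> where "\<kappa> \<in> ?R" "\<forall>r\<in>?R. \<kappa> \<le>o r" by blast
  then have "\<exists>\<kappa>. (\<exists>A. P A \<and> \<kappa> = |A| ) \<and> (\<forall>B. P B \<longrightarrow> \<kappa> \<le>o |B| )" by blast
  from someI_ex[OF this]
  show "\<exists>A. P A \<and> min_size P = |A|" "\<And>B. P B \<Longrightarrow> min_size P \<le>o |B|"
    unfolding min_size_def by auto
qed

text \<open>The larger of two cardinals living on possibly different types, placed on the sum type.\<close>

definition card_max :: "'a rel \<Rightarrow> 'b rel \<Rightarrow> ('a + 'b) rel" where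
  "card_max r s = (if r \<le>o s then |Inr ` Field s| else |Inl ` Field r| )"

lemma card_max_ordIso:
  assumes "Card_order r" "Card_order s"
  shows "r \<le>o s \<Longrightarrow> card_max r s =o s" and "s \<le>o r \<Longrightarrow> card_max r s =o r"
proof -
  have "bij_betw Inr (Field s) (Inr ` Field s)" "bij_betw Inl (Field r) (Inl ` Field r)"
    by (auto simp: bij_betw_def inj_on_def)
  then have "|Field s| =o |Inr ` Field s :: ('a + 'b) set|" "|Field r| =o |Inl ` Field r :: ('a + 'b) set|"
    by (auto intro: card_of_ordIsoI)
  then have img: "|Inr ` Field s :: ('a + 'b) set| =o s" "|Inl ` Field r :: ('a + 'b) set| =o r"
    using assms[THEN card_of_Field_ordIso] ordIso_symmetric ordIso_transitive by blast+
  show "card_max r s =o s" if "r \<le>o s"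
    using that img by (simp add: card_max_def)
  show "card_max r s =o r" if "s \<le>o r"
  proof (cases "r \<le>o s")
    case True
    with that have "s =o r" by (simp add: ordIso_iff_ordLeq)
    with True img(1) show ?thesis by (auto simp: card_max_def intro: ordIso_transitive)
  qed (use img in \<open>simp add: card_max_def\<close>)
qed

definition eventually_le :: "(nat \<Rightarrow> nat) \<Rightarrow> (nat \<Rightarrow> nat) \<Rightarrow> bool" (infix \<open>\<le>\<^sup>*\<close> 50) where
  "f \<le>\<^sup>* g \<longleftrightarrow> (\<forall>\<^sub>\<infinity>n. f n \<le> g n)"

definition unbounded_family :: "(nat \<Rightarrow> nat) set \<Rightarrow> bool" where
  "unbounded_family X \<longleftrightarrow> \<not> (\<exists>g. \<forall>f\<in>X. f \<le>\<^sup>* g)"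

definition bounding_number :: "(nat \<Rightarrow> nat) rel" where
  "bounding_number = min_size unbounded_family"

definition splitting_family :: "nat set set \<Rightarrow> bool" where
  "splitting_family F \<longleftrightarrow> (\<forall>S\<in>F. infinite S) \<and>
     (\<forall>A. infinite A \<longrightarrow> (\<exists>S\<in>F. infinite (A \<inter> S) \<and> infinite (A - S)))"

definition splitting_number :: "nat set rel" where
  "splitting_number = min_size splitting_family"

definition avoids_middles ::
  "(nat \<Rightarrow> nat \<Rightarrow> bool) \<Rightarrow> (nat \<Rightarrow> nat \<Rightarrow> bool) \<Rightarrow> (nat \<Rightarrow> nat) set \<Rightarrow> (nat \<Rightarrow> nat) \<Rightarrow> bool" where
  "avoids_middles R S X g \<longleftrightarrow>
     (\<forall>f\<in>X. infinite {n. R (f n) (g n)}) \<and>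
     (\<forall>f\<in>X. \<forall>h\<in>X. finite {n. R (f n) (g n) \<and> S (g n) (h n)} \<or>
                    finite {n. R (h n) (g n) \<and> S (g n) (f n)})"

definition excluded_middle_property ::
  "(nat \<Rightarrow> nat \<Rightarrow> bool) \<Rightarrow> (nat \<Rightarrow> nat \<Rightarrow> bool) \<Rightarrow> (nat \<Rightarrow> nat) set \<Rightarrow> bool" where
  "excluded_middle_property R S X \<longleftrightarrow> (\<exists>g. avoids_middles R S X g)"

definition excluded_middle_number ::
  "(nat \<Rightarrow> nat \<Rightarrow> bool) \<Rightarrow> (nat \<Rightarrow> nat \<Rightarrow> bool) \<Rightarrow> (nat \<Rightarrow> nat) rel" where
  "excluded_middle_number R S = min_size (\<lambda>X. \<not> excluded_middle_property R S X)"

text \<open>Families of each kind exist, so the minima are attained.\<close>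

lemma unbounded_family_UNIV: "unbounded_family UNIV"
proof -
  have "\<not> (\<lambda>n. Suc (g n)) \<le>\<^sup>* g" for g
    by (simp add: eventually_le_def)
  then show ?thesis unfolding unbounded_family_def by blast
qed

lemma splitting_family_infinite: "splitting_family {S. infinite S}"
  unfolding splitting_family_def
proof (intro conjI ballI allI impI)
  fix A :: "nat set" assume "infinite A"
  then obtain B C where "B \<subseteq> A" "C \<subseteq> A" "infinite B" "infinite C" "B \<inter> C = {}"
    by (rule infinite_split)
  moreover from this have "A \<inter> B = B" "C \<subseteq> A - B" by auto
  ultimately have "infinite B \<and> infinite (A \<inter> B) \<and> infinite (A - B)"
    by (metis finite_subset)
  then show "\<exists>S\<in>{S. infinite S}. infinite (A \<inter> S) \<and> infinite (A - S)"
    by blast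
qed simp

lemma not_excluded_middle_property_UNIV:
  "\<not> excluded_middle_property (<) S UNIV"
proof
  assume "excluded_middle_property (<) S UNIV"
  then obtain g where "avoids_middles (<) S UNIV g"
    unfolding excluded_middle_property_def ..
  then have "infinite {n. g n < g n}"
    unfolding avoids_middles_def by (meson UNIV_I)
  then show False by simp
qed

end

theory Submission
  imports Defs
begin

text \<open>Since avoiding middles for \<open>\<langle><,\<le>\<rangle>\<close> is the stronger requirement, it suffices to
  show \<open>\<xx>\<^bsub><,<\<^esub> \<le> max {\<ss>, \<bb>} \<le> \<xx>\<^bsub><,\<le>\<^esub>\<close>.

  For the first inequality, cut every member \<open>f\<close> of an unbounded family of monotone functions
  down to \<open>S\<close> and to the complement of \<open>S\<close>, for every \<open>S\<close> in a splitting family.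
  If \<open>g\<close> is positive infinitely often, some \<open>f\<close> exceeds \<open>g\<close> at infinitely many of these places,
  and an \<open>S\<close> that splits these places yields middles in both directions.

  For the second inequality, let \<open>X\<close> fail the excluded middle property for \<open>\<langle><,\<le>\<rangle>\<close>.
  It is unbounded, because a strict bound avoids middles. In particular \<open>X\<close> is infinite, so it
  suffices to see that the sets \<open>[f \<le> h]\<close> for \<open>f, h \<in> X\<close>, together with one
  interval union for each \<open>f \<in> X\<close>, form a splitting family. If an infinite set \<open>A\<close> is split by none of them,
  then \<open>X\<close> is linearly ordered by \<open>\<le>\<^sup>*\<close> on \<open>A\<close>, and the function that sends \<open>a \<in> A\<close> to the next element
  of \<open>A\<close>, and everything outside \<open>A\<close> to \<open>0\<close>, avoids middles.\<close>

section \<open>Interval unions that split a set\<close>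

definition splits :: "'a set \<Rightarrow> 'a set \<Rightarrow> bool" where
  "splits S A \<longleftrightarrow> infinite (A \<inter> S) \<and> infinite (A - S)"

definition interval_union :: "(nat \<Rightarrow> nat) \<Rightarrow> nat set" where
  "interval_union F = (\<Union>k. {(F ^^ (2 * k)) 0 ..< (F ^^ Suc (2 * k)) 0})"

text \<open>The iterates \<open>p k\<close> of \<open>F\<close> at 0 partition the naturals into
  consecutive intervals. Since \<open>p k \<ge> k\<close>, the set \<open>A\<close> meets every
  interval from index \<open>N\<close> on: the even ones form the union, the odd ones its
  complement.\<close>

lemma splits_interval_union:
  fixes A :: "nat set"
  assumes F: "\<And>n. n < F n"
    and A: "\<And>n. n \<ge> N \<Longrightarrow> \<exists>a\<in>A. n \<le> a \<and> a < F n"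
  shows "splits (interval_union F) A"
proof -
  define p where "p k = (F ^^ k) 0" for k
  have p_Suc: "p (Suc k) = F (p k)" for k
    by (simp add: p_def)
  have p: "strict_mono p"
    by (simp add: strict_mono_Suc_iff p_Suc F)
  have U: "interval_union F = (\<Union>k. {p (2 * k) ..< p (Suc (2 * k))})"
    by (simp add: interval_union_def p_def)
  have p_ge: "p k \<ge> k" for k
    using p by (rule strict_mono_imp_increasing)
  have hit: "\<exists>a\<in>A. p k \<le> a \<and> a < p (Suc k)" if "k \<ge> N" for k
    using A[of "p k"] p_ge[of k] that by (simp add: p_Suc)
  have "infinite (A \<inter> interval_union F)"
    unfolding infinite_nat_iff_unbounded_le
  proof
    fix m
    define k where "k = m + N"
    obtain a where "a \<in> A" "p (2 * k) \<le> a" "a < p (Suc (2 * k))"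
      using hit[of "2 * k"] by (auto simp: k_def)
    moreover have "m \<le> p (2 * k)"
      using p_ge[of "2 * k"] by (simp add: k_def)
    ultimately show "\<exists>n\<ge>m. n \<in> A \<inter> interval_union F"
      unfolding U by (intro exI[of _ a]) auto
  qed
  moreover have "infinite (A - interval_union F)"
    unfolding infinite_nat_iff_unbounded_le
  proof
    fix m
    define j where "j = Suc (2 * (m + N))"
    obtain a where a: "a \<in> A" "p j \<le> a" "a < p (Suc j)"
      using hit[of j] unfolding j_def by auto
    have "a \<notin> interval_union F"
    proof
      assume "a \<in> interval_union F"
      then obtain k where k: "p (2 * k) \<le> a" "a < p (Suc (2 * k))"
        unfolding U by auto
      \<comment> \<open>Strict monotonicity of \<open>p\<close> would force
        \<open>j = 2 * k\<close>, but \<open>j\<close> is odd.\<close>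
      have "2 * k < Suc j" "j < Suc (2 * k)"
        using le_less_trans[OF k(1) a(3)] le_less_trans[OF a(2) k(2)] p
        by (simp_all only: strict_mono_less)
      then show False
        unfolding j_def by presburger
    qed
    moreover have "m \<le> a"
      using p_ge[of j] a(2) unfolding j_def by simp
    ultimately show "\<exists>n\<ge>m. n \<in> A - interval_union F"
      using a(1) by blast
  qed
  ultimately show ?thesis
    by (simp add: splits_def)
qed

definition next_in :: "nat set \<Rightarrow> nat \<Rightarrow> nat" where
  "next_in A n = (LEAST a. a \<in> A \<and> n < a)"

lemma next_in:
  assumes "infinite A"
  shows next_in_mem: "next_in A n \<in> A" and next_in_greater: "n < next_in A n"
proof -
  have "\<exists>a. a \<in> A \<and> n < a"
    using assms by (auto simp: infinite_nat_iff_unbounded)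
  then have "next_in A n \<in> A \<and> n < next_in A n"
    unfolding next_in_def by (rule LeastI_ex)
  then show "next_in A n \<in> A" "n < next_in A n" by auto
qed

text \<open>A monotone majorant of \<open>f\<close>. The summand \<open>n\<close> and the successor
  also put it above the identity, so that its iterates generate intervals.\<close>

definition partial_sum_succ :: "(nat \<Rightarrow> nat) \<Rightarrow> nat \<Rightarrow> nat" where
  "partial_sum_succ f n = Suc (n + (\<Sum>i\<le>n. f i))"

lemma le_partial_sum_succ: "m \<le> n \<Longrightarrow> f m < partial_sum_succ f n"
  using member_le_sum[of m "{..n}" f] by (simp add: partial_sum_succ_def less_Suc_eq_le)

text \<open>Let \<open>a\<close> be the last element of \<open>A\<close> below a large
  \<open>n\<close>. The next element of \<open>A\<close> is at least \<open>n\<close> and at most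
  \<open>f a\<close>, hence below \<open>partial_sum_succ f n\<close>; so \<open>A\<close> meets
  each such interval.\<close>

lemma splits_interval_union_partial_sum_succ:
  assumes A: "infinite A" and fin: "finite {a \<in> A. f a < next_in A a}"
  shows "splits (interval_union (partial_sum_succ f)) A"
proof -
  obtain M where M: "\<And>a. a \<in> A \<Longrightarrow> f a < next_in A a \<Longrightarrow> a \<le> M"
    using fin by (auto simp: finite_nat_set_iff_bounded_le)
  \<comment> \<open>An element of \<open>A\<close> past all exceptions: for \<open>n > c\<close>,
    the last element of \<open>A\<close> below \<open>n\<close> exists and is no exception.\<close>
  define c where "c = next_in A M"
  have c: "c \<in> A" "M < c"
    unfolding c_def using A by (rule next_in)+
  show ?thesis
  proof (rule splits_interval_union)
    show "n < partial_sum_succ f n" for n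
      by (simp add: partial_sum_succ_def)
    fix n assume n: "Suc c \<le> n"
    let ?P = "{a \<in> A. a < n}"
    define a where "a = Max ?P"
    have P: "finite ?P" "c \<in> ?P"
      using c n by auto
    have a: "a \<in> A" "a < n"
      using Max_in[OF P(1)] P(2) unfolding a_def by blast+
    have "c \<le> a"
      unfolding a_def using P by (rule Max_ge)
    with M[OF a(1)] c have "next_in A a \<le> f a"
      by fastforce
    also have "f a < partial_sum_succ f n"
      using a(2) by (intro le_partial_sum_succ) simp
    finally have lt: "next_in A a < partial_sum_succ f n" .
    have nx: "next_in A a \<in> A" "a < next_in A a"
      using A by (rule next_in)+
    have "n \<le> next_in A a"
    proof (rule ccontr)
      assume "\<not> n \<le> next_in A a"
      with nx have "next_in A a \<le> a"
        unfolding a_def[symmetric] using Max_ge[OF P(1), of "next_in A a"] a_def by simp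
      with nx show False by simp
    qed
    with nx lt show "\<exists>a\<in>A. n \<le> a \<and> a < partial_sum_succ f n" by blast
  qed
qed

section \<open>Splitting families from families without excluded middles\<close>

lemma excluded_middle_property_bounded:
  assumes "\<not> unbounded_family X"
  shows "excluded_middle_property (<) (\<le>) X"
proof -
  obtain g where g: "\<And>f. f \<in> X \<Longrightarrow> \<forall>\<^sub>\<infinity>n. f n \<le> g n"
    using assms by (auto simp: unbounded_family_def eventually_le_def)
  have "infinite {n. f n < Suc (g n)}" if "f \<in> X" for f
  proof -
    have "\<exists>\<^sub>\<infinity>n. f n < Suc (g n)"
      using eventually_frequently[OF _ g[OF that]] by (simp add: less_Suc_eq_le)
    then show ?thesis
      by (simp add: frequently_cofinite)
  qed
  moreover have "finite {n. f n < Suc (g n) \<and> Suc (g n) \<le> h n}" if "h \<in> X" for f h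
    using g[OF that] unfolding eventually_cofinite by (rule rev_finite_subset) auto
  ultimately have "avoids_middles (<) (\<le>) X (\<lambda>n. Suc (g n))"
    by (auto simp: avoids_middles_def)
  then show ?thesis
    by (auto simp: excluded_middle_property_def)
qed

text \<open>The pointwise sum bounds a finite family. Infinity allows the cardinal arithmetic
  below.\<close>

lemma infinite_unbounded_family:
  assumes "unbounded_family X"
  shows "infinite X"
proof
  assume fin: "finite X"
  have "f \<le>\<^sup>* (\<lambda>n. \<Sum>h\<in>X. h n)" if "f \<in> X" for f
    unfolding eventually_le_def using fin that by (intro always_eventually allI member_le_sum) auto
  with assms show False
    by (auto simp: unbounded_family_def)
qed

text \<open>Members of a splitting family must be infinite, hence the filter; it discards only sets
  that split nothing.\<close>

definition comparison_family :: "(nat \<Rightarrow> nat) set \<Rightarrow> nat set set" where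
  "comparison_family X = {S \<in> (\<lambda>(f, h). {n. f n \<le> h n}) ` (X \<times> X) \<union>
     (\<lambda>f. interval_union (partial_sum_succ f)) ` X. infinite S}"

lemma splitting_family_comparison_family:
  assumes X: "\<not> excluded_middle_property (<) (\<le>) X"
  shows "splitting_family (comparison_family X)"
proof (rule ccontr)
  assume "\<not> splitting_family (comparison_family X)"
  moreover have "\<forall>S\<in>comparison_family X. infinite S"
    by (simp add: comparison_family_def)
  ultimately obtain A where A: "infinite A"
    and unsplit: "\<And>S. S \<in> comparison_family X \<Longrightarrow> \<not> splits S A"
    unfolding splitting_family_def splits_def by blast
  have split_inf: "infinite S" if "splits S A" for S
    using that unfolding splits_def by blast
  \<comment> \<open>The value 0 off \<open>A\<close> makes \<open>f n < g n\<close> fail there, so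
    that all middles lie in \<open>A\<close>.\<close>
  define g where "g n = (if n \<in> A then next_in A n else 0)" for n
  have "infinite {n. f n < g n}" if "f \<in> X" for f
  proof
    assume "finite {n. f n < g n}"
    then have "finite {a \<in> A. f a < next_in A a}"
      by (rule rev_finite_subset) (auto simp: g_def)
    with A have sp: "splits (interval_union (partial_sum_succ f)) A"
      by (rule splits_interval_union_partial_sum_succ)
    with split_inf that have "interval_union (partial_sum_succ f) \<in> comparison_family X"
      by (auto simp: comparison_family_def)
    with sp unsplit show False by blast
  qed
  moreover have "finite {n. f n < g n \<and> g n \<le> h n} \<or> finite {n. h n < g n \<and> g n \<le> f n}"
    if fh: "f \<in> X" "h \<in> X" for f h
  proof -
    \<comment> \<open>On \<open>A\<close>, either \<open>f \<le> h\<close> or \<open>h < f\<close>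
      holds almost everywhere; each excludes one of the two kinds of middles up to finitely many
      places.\<close>
    have "\<not> splits {n. f n \<le> h n} A"
      using split_inf unsplit fh by (auto simp: comparison_family_def)
    then have "finite (A \<inter> {n. f n \<le> h n}) \<or> finite (A - {n. f n \<le> h n})"
      by (simp add: splits_def)
    moreover have "n \<in> A" if "f n < g n \<or> h n < g n" for n
      using that by (auto simp: g_def split: if_splits)
    then have "{n. f n < g n \<and> g n \<le> h n} \<subseteq> A \<inter> {n. f n \<le> h n}"
      "{n. h n < g n \<and> g n \<le> f n} \<subseteq> A - {n. f n \<le> h n}"
      by auto
    ultimately show ?thesis
      by (blast intro: finite_subset)
  qed
  ultimately have "avoids_middles (<) (\<le>) X g"
    by (simp add: avoids_middles_def)
  with X show False
    by (auto simp: excluded_middle_property_def)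
qed

lemma card_of_comparison_family:
  assumes "infinite X"
  shows "|comparison_family X| \<le>o |X|"
proof -
  let ?P = "(\<lambda>(f, h). {n. f n \<le> h n}) ` (X \<times> X)"
    and ?Q = "(\<lambda>f. interval_union (partial_sum_succ f)) ` X"
  have "|?P| \<le>o |X|"
    by (rule ordLeq_ordIso_trans[OF card_of_image card_of_Times_same_infinite[OF assms]])
  then have "|?P \<union> ?Q| \<le>o |X|"
    using assms card_of_image card_of_Card_order
    by (intro card_of_Un_ordLeq_infinite_Field) (simp_all add: Field_card_of)
  moreover have "|comparison_family X| \<le>o |?P \<union> ?Q|"
    by (rule card_of_mono1) (auto simp: comparison_family_def)
  ultimately show ?thesis
    by (rule ordLeq_transitive[rotated])
qed

section \<open>Cut functions without excluded middles\<close>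

lemma infinite_exceeds_on_infinite:
  fixes g :: "nat \<Rightarrow> nat"
  assumes B: "unbounded_family B" and A: "infinite A"
  shows "\<exists>f\<in>B. infinite {n \<in> A. g n < partial_sum_succ f n}"
proof (rule ccontr)
  assume neg: "\<not> ?thesis"
  \<comment> \<open>If the claim fails, \<open>g\<close> dominates the majorant of \<open>f\<close>
    almost everywhere on \<open>A\<close>. The majorant at the next element of \<open>A\<close> is
    above \<open>f n\<close>, so this bound does not depend on \<open>f\<close> and contradicts
    unboundedness.\<close>
  have "f \<le>\<^sup>* (\<lambda>n. g (next_in A n))" if "f \<in> B" for f
  proof -
    have "finite {n \<in> A. g n < partial_sum_succ f n}"
      using neg that by blast
    then obtain M where M: "\<And>n. n \<in> A \<Longrightarrow> g n < partial_sum_succ f n \<Longrightarrow> n \<le> M"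
      by (auto simp: finite_nat_set_iff_bounded_le)
    have "f n \<le> g (next_in A n)" if "n \<ge> M" for n
    proof -
      have nx: "next_in A n \<in> A" "n < next_in A n"
        using A by (rule next_in)+
      have "f n \<le> partial_sum_succ f (next_in A n)"
        using nx(2) by (intro less_imp_le le_partial_sum_succ) simp
      also have "\<dots> \<le> g (next_in A n)"
        using M[OF nx(1)] nx(2) that by fastforce
      finally show ?thesis .
    qed
    then show ?thesis
      unfolding eventually_le_def cofinite_eq_sequentially eventually_sequentially by blast
  qed
  with B show False
    by (auto simp: unbounded_family_def)
qed

text \<open>The default 0 lies below \<open>g\<close> wherever \<open>g\<close> is positive, which
  supplies the lower side of a middle.\<close>

definition cut :: "'a set \<Rightarrow> ('a \<Rightarrow> nat) \<Rightarrow> 'a \<Rightarrow> nat" where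
  "cut S f n = (if n \<in> S then f n else 0)"

definition cut_family :: "(nat \<Rightarrow> nat) set \<Rightarrow> nat set set \<Rightarrow> (nat \<Rightarrow> nat) set" where
  "cut_family B F = (\<lambda>(f, S). cut S (partial_sum_succ f)) ` (B \<times> F) \<union>
     (\<lambda>(f, S). cut (- S) (partial_sum_succ f)) ` (B \<times> F)"

lemma not_excluded_middle_property_cut_family:
  assumes B: "unbounded_family B" and F: "splitting_family F"
  shows "\<not> excluded_middle_property (<) (<) (cut_family B F)"
proof
  assume "excluded_middle_property (<) (<) (cut_family B F)"
  then obtain g where inf: "\<And>f. f \<in> cut_family B F \<Longrightarrow> infinite {n. f n < g n}"
    and mid: "\<And>f h. f \<in> cut_family B F \<Longrightarrow> h \<in> cut_family B F \<Longrightarrow>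
      finite {n. f n < g n \<and> g n < h n} \<or> finite {n. h n < g n \<and> g n < f n}"
    unfolding excluded_middle_property_def avoids_middles_def by blast
  have cut_mem: "cut S (partial_sum_succ f) \<in> cut_family B F"
    "cut (- S) (partial_sum_succ f) \<in> cut_family B F" if "f \<in> B" "S \<in> F" for f S
    using that by (auto simp: cut_family_def)
  \<comment> \<open>Any single member of the cut family shows that \<open>g\<close> is positive
    infinitely often.\<close>
  obtain f S where "f \<in> B" "S \<in> F"
    using infinite_imp_nonempty[OF infinite_unbounded_family[OF B]] F
    unfolding splitting_family_def by blast
  from inf[OF cut_mem(1)[OF this]] have "infinite {n. 0 < g n}"
    by (rule infinite_super[rotated]) auto
  then obtain f where f: "f \<in> B"
    and infA: "infinite {n \<in> {n. 0 < g n}. g n < partial_sum_succ f n}" (is "infinite ?A")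
    using infinite_exceeds_on_infinite[OF B] by blast
  then obtain S where S: "S \<in> F" "infinite (?A \<inter> S)" "infinite (?A - S)"
    using F unfolding splitting_family_def by blast
  let ?h = "cut S (partial_sum_succ f)" and ?k = "cut (- S) (partial_sum_succ f)"
  \<comment> \<open>On either side of \<open>S\<close> one cut is 0 and the other is the full
    majorant, which exceeds \<open>g\<close> on \<open>?A\<close>.\<close>
  have "?A \<inter> S = {n. ?k n < g n \<and> g n < ?h n}" "?A - S = {n. ?h n < g n \<and> g n < ?k n}"
    by (auto simp: cut_def)
  with S mid[OF cut_mem[OF f S(1)]] show False by simp
qed

lemma card_of_cut_family:
  assumes "infinite C" "|B| \<le>o |C|" "|F| \<le>o |C|"
  shows "|cut_family B F| \<le>o |C|"
proof -
  have "|B \<times> F| \<le>o |C|"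
    using assms by (intro card_of_Sigma_ordLeq_infinite) simp_all
  then have "|\<phi> ` (B \<times> F)| \<le>o |C|" for \<phi> :: "_ \<Rightarrow> nat \<Rightarrow> nat"
    using card_of_image ordLeq_transitive by blast
  then show ?thesis
    unfolding cut_family_def using assms(1) card_of_Card_order
    by (intro card_of_Un_ordLeq_infinite_Field) (simp_all add: Field_card_of)
qed

section \<open>Comparison of the cardinals\<close>

lemma excluded_middle_number_leq_card_max:
  "excluded_middle_number (<) (<) \<le>o card_max splitting_number bounding_number"
proof -
  obtain B where B: "unbounded_family B" "bounding_number = |B|"
    unfolding bounding_number_def using min_size(1)[of unbounded_family, OF unbounded_family_UNIV] by blast
  obtain F where F: "splitting_family F" "splitting_number = |F|"
    unfolding splitting_number_def using min_size(1)[of splitting_family, OF splitting_family_infinite] by blast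
  have card_max: "|F| \<le>o |B| \<Longrightarrow> card_max |F| |B| =o |B|" "|B| \<le>o |F| \<Longrightarrow> card_max |F| |B| =o |F|"
    by (simp_all add: card_max_ordIso card_of_Card_order)
  have B_inf: "infinite B"
    using B(1) by (rule infinite_unbounded_family)
  \<comment> \<open>The larger of \<open>B\<close> and \<open>F\<close> is infinite because
    \<open>B\<close> is, so it absorbs the product \<open>B \<times> F\<close>.\<close>
  have "|cut_family B F| \<le>o card_max |F| |B|"
  proof (cases "|F| \<le>o |B|")
    case True
    show ?thesis
      using card_of_cut_family[OF B_inf card_of_mono1[OF subset_refl] True]
        ordIso_symmetric[OF card_max(1)[OF True]] by (rule ordLeq_ordIso_trans)
  next
    case False
    then have le: "|B| \<le>o |F|"
      using ordLeq_total[OF card_of_Well_order card_of_Well_order] by blast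
    then have F_inf: "infinite F"
      using B_inf by (rule card_of_ordLeq_infinite)
    show ?thesis
      using card_of_cut_family[OF F_inf le card_of_mono1[OF subset_refl]]
        ordIso_symmetric[OF card_max(2)[OF le]] by (rule ordLeq_ordIso_trans)
  qed
  moreover have "excluded_middle_number (<) (<) \<le>o |cut_family B F|"
    unfolding excluded_middle_number_def
    using not_excluded_middle_property_cut_family[OF B(1) F(1)] by (intro min_size(2))
  ultimately show ?thesis
    unfolding B(2) F(2) by (rule ordLeq_transitive[rotated])
qed

lemma card_max_leq_excluded_middle_number:
  "card_max splitting_number bounding_number \<le>o excluded_middle_number (<) (\<le>)"
proof -
  obtain X where X: "\<not> excluded_middle_property (<) (\<le>) X"
    and card_X: "excluded_middle_number (<) (\<le>) = |X|"
    unfolding excluded_middle_number_def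
    using min_size(1)[of "\<lambda>X. \<not> excluded_middle_property (<) (\<le>) X", OF not_excluded_middle_property_UNIV] by blast
  have unb: "unbounded_family X"
    using X excluded_middle_property_bounded by blast
  have b: "bounding_number \<le>o |X|"
    unfolding bounding_number_def using unb by (rule min_size(2)[of unbounded_family, OF unbounded_family_UNIV])
  have "splitting_number \<le>o |comparison_family X|"
    unfolding splitting_number_def using splitting_family_comparison_family[OF X]
    by (rule min_size(2)[of splitting_family, OF splitting_family_infinite])
  then have s: "splitting_number \<le>o |X|"
    using card_of_comparison_family[OF infinite_unbounded_family[OF unb]] by (rule ordLeq_transitive)
  have co: "Card_order splitting_number" "Card_order bounding_number"
    unfolding splitting_number_def bounding_number_def
    using min_size(1)[of splitting_family, OF splitting_family_infinite] min_size(1)[of unbounded_family, OF unbounded_family_UNIV]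
    by (auto simp: card_of_Card_order)
  then have "splitting_number \<le>o bounding_number \<or> bounding_number \<le>o splitting_number"
    by (intro ordLeq_total) (auto simp: card_order_on_def)
  then show ?thesis
  proof
    assume "splitting_number \<le>o bounding_number"
    from card_max_ordIso(1)[OF co this] b show ?thesis
      unfolding card_X by (rule ordIso_ordLeq_trans)
  next
    assume "bounding_number \<le>o splitting_number"
    from card_max_ordIso(2)[OF co this] s show ?thesis
      unfolding card_X by (rule ordIso_ordLeq_trans)
  qed
qed

lemma excluded_middle_number_mono:
  "excluded_middle_number (<) (\<le>) \<le>o excluded_middle_number (<) (<)"
proof -
  obtain X where X: "\<not> excluded_middle_property (<) (<) X"
    and card_X: "excluded_middle_number (<) (<) = |X|"
    unfolding excluded_middle_number_def
    using min_size(1)[of "\<lambda>X. \<not> excluded_middle_property (<) (<) X", OF not_excluded_middle_property_UNIV] by blast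
  have "avoids_middles (<) (<) X g" if "avoids_middles (<) (\<le>) X g" for g
  proof -
    have "finite {n. f n < g n \<and> g n < h n}" if "finite {n. f n < g n \<and> g n \<le> h n}" for f h
      using that by (rule rev_finite_subset) auto
    with that show ?thesis
      unfolding avoids_middles_def by blast
  qed
  with X have "\<not> excluded_middle_property (<) (\<le>) X"
    by (auto simp: excluded_middle_property_def)
  then show ?thesis
    unfolding card_X by (subst excluded_middle_number_def) (intro min_size(2))
qed

theorem theorem3p4:
  shows "excluded_middle_number (<) (\<le>) =o excluded_middle_number (<) (<) \<and>
         excluded_middle_number (<) (<) =o card_max splitting_number bounding_number"
proof
  \<comment> \<open>The three inequalities close a cycle, so all three cardinals agree.\<close>
  note leq = excluded_middle_number_mono excluded_middle_number_leq_card_max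
    card_max_leq_excluded_middle_number
  show "excluded_middle_number (<) (\<le>) =o excluded_middle_number (<) (<)"
    using leq(1) ordLeq_transitive[OF leq(2,3)] by (simp add: ordIso_iff_ordLeq)
  show "excluded_middle_number (<) (<) =o card_max splitting_number bounding_number"
    using leq(2) ordLeq_transitive[OF leq(3,1)] by (simp add: ordIso_iff_ordLeq)
qed

end
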